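(* Let $n_1,n_2$ be positive integers and $n=\min\{n_1,n_2\}$. Let $f\in\mathcal{A}_{n_1}$ and $g\in\mathcal{A}_{n_2}\cap\mathcal{S}^{*}$. Let $\beta\ge0$, $\gamma\ge0$ be real with $\beta+\gamma>0$, let $0<\mu\le1$ and $\delta>0$ be real, and let $\rho$ be a real number with $\rho>\sqrt{\dfrac{\delta}{\delta+\mu n}}$. Suppose that $$ \left|\left(\frac{zf'(z)}{g(z)}\right)^{\frac1\mu}-1\right|^{\beta}\left|\delta+1+\frac{zf''(z)}{f'(z)}-\frac{zg'(z)}{g(z)}\right|^{\gamma}<\rho^{\beta}\left(\delta+\frac{\mu\rho n}{1+\rho}\right)^{\gamma}\qquad\text{for all } z\in\mathbb{U}. $$ Then $$ \left|\left(\frac{zf'(z)}{g(z)}\right)^{\frac1\mu}-1\right|<\rho\qquad\text{for all } z\in\mathbb{U}. $$ If in addition $\rho<1$, then $f\in\mathcal{STC}(\mu)$.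
   Context: $\mathbb{U}=\{z\in\mathbb{C}:|z|<1\}$ is the open unit disk. For a positive integer $m$, $\mathcal{A}_m$ is the class of functions analytic in $\mathbb{U}$ of the form $f(z)=z+a_{m+1}z^{m+1}+a_{m+2}z^{m+2}+\cdots$; $\mathcal{A}=\mathcal{A}_1$ (which contains every $\mathcal{A}_m$). $\mathcal{S}^{*}$ is the class of functions $g\in\mathcal{A}$ with $\mathrm{Re}\left(\frac{zg'(z)}{g(z)}\right)>0$ for all $z\in\mathbb{U}$ (starlike functions). Quotients such as $zg'(z)/g(z)$ and $zf'(z)/g(z)$ are given their limiting value $1$ at $z=0$; $g$ has no zero in $\mathbb{U}\setminus\{0\}$. For $0<\mu\le1$, $\mathcal{STC}(\mu)$ (strongly close-to-convex functions of order $\mu$) is the class of $f\in\mathcal{A}$ for which there exists $g\in\mathcal{S}^{*}$ with $\mathrm{Re}\left(\left(\frac{zf'(z)}{g(z)}\right)^{1/\mu}\right)>0$ for all $z\in\mathbb{U}$. Conventions: the expressions in the hypothesis are understood to be well defined, so $f'(z)\ne0$ in $\mathbb{U}$. The power $(zf'(z)/g(z))^{1/\mu}$ is the analytic branch in $\mathbb{U}$ with value $1$ at $z=0$. Real powers of nonnegative reals have their usual meaning, with $x^0=1$ (including $x=0$). *)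

theory Defs
  imports "HOL-Complex_Analysis.Complex_Analysis"
begin

abbreviation unit_disk :: "complex set" where
  "unit_disk \<equiv> ball 0 1"

text \<open>Functions are total; only their values on the unit disk matter below.\<close>

definition class_A :: "nat \<Rightarrow> (complex \<Rightarrow> complex) set" where
  "class_A m = {f. f holomorphic_on unit_disk \<and>
     (\<exists>a. \<forall>z\<in>unit_disk. (\<lambda>k. a k * z ^ (m + 1 + k)) sums (f z - z))}"

text \<open>The quotient \<open>z h'(z) / g(z)\<close>. For \<open>h\<close> and \<open>g\<close> in \<open>class_A 1\<close> its limit at the
  removable singularity \<open>0\<close> is \<open>h'(0) / g'(0) = 1\<close>, which is taken as its value there.\<close>

definition zderiv_quot :: "(complex \<Rightarrow> complex) \<Rightarrow> (complex \<Rightarrow> complex) \<Rightarrow> complex \<Rightarrow> complex" where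
  "zderiv_quot h g z = (if z = 0 then 1 else z * deriv h z / g z)"

definition starlike_class :: "(complex \<Rightarrow> complex) set" where
  "starlike_class = {g \<in> class_A 1. (\<forall>z\<in>unit_disk - {0}. g z \<noteq> 0) \<and>
     (\<forall>z\<in>unit_disk. Re (zderiv_quot g g z) > 0)}"

text \<open>The logarithm of \<open>q\<close> that is holomorphic on the disk and vanishes at \<open>0\<close>. It exists, and
  is unique on the disk, if \<open>q\<close> is holomorphic without zeros there and \<open>q 0 = 1\<close>; for other \<open>q\<close>
  the value is unspecified. The function \<open>disk_powr q a\<close> is then the branch of
  \<open>q\<^sup>a\<close> with value \<open>1\<close> at \<open>0\<close>; it need not be the principal power of \<open>q z\<close>.\<close>

definition disk_log :: "(complex \<Rightarrow> complex) \<Rightarrow> complex \<Rightarrow> complex" where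
  "disk_log q = (SOME L. L holomorphic_on unit_disk \<and> L 0 = 0 \<and>
     (\<forall>z\<in>unit_disk. exp (L z) = q z))"

definition disk_powr :: "(complex \<Rightarrow> complex) \<Rightarrow> real \<Rightarrow> complex \<Rightarrow> complex" where
  "disk_powr q a z = exp (of_real a * disk_log q z)"

lemma disk_log_spec:
  assumes "q holomorphic_on unit_disk" "\<And>z. z \<in> unit_disk \<Longrightarrow> q z \<noteq> 0" "q 0 = 1"
  shows "disk_log q holomorphic_on unit_disk \<and> disk_log q 0 = 0 \<and>
    (\<forall>z\<in>unit_disk. exp (disk_log q z) = q z)"
proof -
  obtain L where L: "L holomorphic_on unit_disk" "\<And>z. z \<in> unit_disk \<Longrightarrow> exp (L z) = q z"
    using contractible_imp_holomorphic_log[OF assms(1) convex_imp_contractible[OF convex_ball]]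
      assms(2) by metis
  have "exp (L 0) = 1"
    using L(2)[of 0] assms(3) by simp
  then have "(\<lambda>z. L z - L 0) holomorphic_on unit_disk \<and> L 0 - L 0 = 0 \<and>
      (\<forall>z\<in>unit_disk. exp (L z - L 0) = q z)"
    using L by (auto simp: exp_diff intro!: holomorphic_intros)
  then show ?thesis
    unfolding disk_log_def
    by (rule someI[where P = "\<lambda>L. L holomorphic_on unit_disk \<and> L 0 = 0 \<and>
      (\<forall>z\<in>unit_disk. exp (L z) = q z)"])
qed

text \<open>In \<open>HOL\<close> we have \<open>0 powr 0 = 0\<close>, whereas here \<open>0\<close> to the power \<open>0\<close> has to be \<open>1\<close>.\<close>

definition rpow :: "real \<Rightarrow> real \<Rightarrow> real" where
  "rpow x a = (if a = 0 then 1 else x powr a)"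

text \<open>Strongly close-to-convex functions of order \<open>\<mu>\<close>, for \<open>0 < \<mu> \<le> 1\<close>. The condition
  \<open>f' \<noteq> 0\<close> makes the power of the quotient well defined.\<close>

definition STC :: "real \<Rightarrow> (complex \<Rightarrow> complex) set" where
  "STC \<mu> = {f \<in> class_A 1. (\<forall>z\<in>unit_disk. deriv f z \<noteq> 0) \<and>
     (\<exists>g\<in>starlike_class. \<forall>z\<in>unit_disk. Re (disk_powr (zderiv_quot f g) (1 / \<mu>) z) > 0)}"

end

theory Submission
  imports Defs
begin

text \<open>Put \<open>q = z f' / g\<close> and \<open>Q = q\<^bsup>1/\<mu>\<^esup>\<close>, so that
  \<open>1 + z f'' / f' - z g' / g = z q' / q = \<mu> z Q' / Q\<close>. If \<open>|Q - 1| < \<rho>\<close> fails, let \<open>z0\<close> be a point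
  of least modulus with \<open>|Q z0 - 1| = \<rho>\<close>. As \<open>Q - 1\<close> vanishes at \<open>0\<close> to order at least \<open>n\<close>,
  Jack's lemma gives \<open>z0 Q'(z0) = k (Q z0 - 1)\<close> with a real \<open>k \<ge> n\<close>. With \<open>t = Q z0 - 1\<close>, the second
  factor of the hypothesis becomes \<open>|\<delta> + \<mu> k t / (1 + t)|\<close>, which on \<open>|t| = \<rho>\<close> is at least
  \<open>\<delta> + \<mu> \<rho> n / (1 + \<rho>)\<close>; this contradicts the hypothesis at \<open>z0\<close>.\<close>

section \<open>Jack's lemma: logarithmic derivatives at a point of maximum modulus\<close>

text \<open>Along an inward spiral of slope \<open>s\<close> the real part of
  \<open>h / h z0\<close> starts at 1 with derivative \<open>s * Im c - Re c\<close>, where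
  \<open>c\<close> is the quotient in the conclusion. A positive derivative would push
  \<open>cmod h\<close> above its maximum. Large \<open>s\<close> of either sign force
  \<open>Im c = 0\<close>, and \<open>s = 0\<close> gives the sign of \<open>Re c\<close>.\<close>

lemma logderiv_nonneg_at_max:
  fixes h :: "complex \<Rightarrow> complex"
  assumes h: "h holomorphic_on ball 0 R" and z0: "z0 \<in> ball 0 R" and nz: "h z0 \<noteq> 0"
    and le: "\<And>z. cmod z \<le> cmod z0 \<Longrightarrow> cmod (h z) \<le> cmod (h z0)"
  shows "Im (z0 * deriv h z0 / h z0) = 0 \<and> Re (z0 * deriv h z0 / h z0) \<ge> 0"
proof -
  define c where "c = z0 * deriv h z0 / h z0"
  \<comment> \<open>Moving from \<open>z0\<close> along \<open>z0 exp (- (1 + i s) t)\<close> for \<open>t \<ge> 0\<close> stays in the disk.\<close>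
  have key: "s * Im c \<le> Re c" for s :: real
  proof (rule ccontr)
    assume neg: "\<not> s * Im c \<le> Re c"
    define v where "v = - Complex 1 s"
    define k where "k t = z0 * exp (v * of_real t)" for t :: real
    have dh: "(h has_field_derivative deriv h z0) (at z0)"
      using h z0 by (intro holomorphic_derivI[of h "ball 0 R"]) auto
    have "(k has_vector_derivative z0 * v) (at 0)"
      unfolding k_def
      by (rule has_vector_derivative_eq_rhs, rule has_vector_derivative_real_field)
         (auto intro!: derivative_eq_intros)
    then have "((h \<circ> k) has_vector_derivative z0 * v * deriv h z0) (at 0)"
      using field_vector_diff_chain_at[of k "z0 * v" 0 h "deriv h z0"] dh by (simp add: k_def)
    then have G: "((\<lambda>t. h (k t) / h z0) has_vector_derivative z0 * v * deriv h z0 / h z0) (at 0)"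
      unfolding o_def by (rule has_vector_derivative_divide)
    define G where "G t = h (k t) / h z0" for t
    have G': "(G has_vector_derivative v * c) (at 0)"
      using G by (simp add: G_def[abs_def] c_def mult_ac)
    have G0: "G 0 = 1" using nz by (simp add: G_def k_def)
    have "((\<lambda>t. Re (G t)) has_real_derivative Re (v * c)) (at 0)"
      using G' by (auto simp: has_vector_derivative_complex_iff)
    moreover have "Re (v * c) > 0"
      using neg by (simp add: v_def algebra_simps)
    ultimately obtain d where d: "d > 0" "\<And>t. 0 < t \<Longrightarrow> t < d \<Longrightarrow> Re (G 0) < Re (G (0 + t))"
      using DERIV_pos_inc_right[of "\<lambda>t. Re (G t)" "Re (v * c)" 0] by blast
    have "Re (G 0) < Re (G (d/2))" using d(2)[of "d/2"] d(1) by simp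
    moreover have "cmod (k (d/2)) \<le> cmod z0"
      using d(1) by (simp add: k_def v_def norm_mult mult_left_le)
    then have "cmod (G (d/2)) \<le> 1"
      using le nz by (simp add: G_def norm_divide)
    ultimately show False
      using complex_Re_le_cmod[of "G (d/2)"] G0 by simp
  qed
  have "Im c = 0"
  proof (rule ccontr)
    assume "Im c \<noteq> 0"
    then show False using key[of "(Re c + 1) / Im c"] by simp
  qed
  then show ?thesis using key[of 0] by (simp add: c_def)
qed

text \<open>Jack's lemma. By the maximum principle \<open>h\<close> is maximal at \<open>z0\<close> as well, and the logarithmic
  derivative of \<open>z ^ n\<close> contributes \<open>n\<close>.\<close>

lemma Jack:
  fixes h w :: "complex \<Rightarrow> complex"
  assumes h: "h holomorphic_on ball 0 R" and w: "\<And>z. z \<in> ball 0 R \<Longrightarrow> w z = z ^ n * h z"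
    and z0: "z0 \<in> ball 0 R" and wnz: "w z0 \<noteq> 0" and z0nz: "z0 \<noteq> 0"
    and le: "\<And>z. cmod z = cmod z0 \<Longrightarrow> cmod (w z) \<le> cmod (w z0)"
  obtains k :: real where "k \<ge> n" "z0 * deriv w z0 = of_real k * w z0"
proof -
  have hnz: "h z0 \<noteq> 0" using w[OF z0] wnz by auto
  \<comment> \<open>On this circle \<open>z ^ n\<close> has constant modulus, so the maximality of
    \<open>w\<close> passes to \<open>h\<close>.\<close>
  have circ: "cmod (h z) \<le> cmod (h z0)" if "cmod z = cmod z0" for z
    using le[OF that] w[of z] w[of z0] z0 z0nz that by (simp add: norm_mult norm_power)
  have hle: "cmod (h z) \<le> cmod (h z0)" if "cmod z \<le> cmod z0" for z
  proof (rule maximum_modulus_frontier[of h "cball 0 (cmod z0)"])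
    show "h holomorphic_on interior (cball 0 (cmod z0))"
      using z0 by (intro holomorphic_on_subset[OF h]) auto
    show "continuous_on (closure (cball 0 (cmod z0))) h"
      using z0 by (intro holomorphic_on_imp_continuous_on holomorphic_on_subset[OF h]) auto
  qed (use circ that z0nz in \<open>auto simp: frontier_cball\<close>)
  define c where "c = z0 * deriv h z0 / h z0"
  have c: "Im c = 0" "Re c \<ge> 0"
    using logderiv_nonneg_at_max[OF h z0 hnz hle] by (auto simp: c_def)
  have dh: "(h has_field_derivative deriv h z0) (at z0)"
    using h z0 by (intro holomorphic_derivI[of h "ball 0 R"]) auto
  have "((\<lambda>z. z ^ n * h z) has_field_derivative of_nat n * z0 ^ (n - 1) * h z0 + z0 ^ n * deriv h z0) (at z0)"
    by (auto intro!: derivative_eq_intros dh)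
  then have "(w has_field_derivative of_nat n * z0 ^ (n - 1) * h z0 + z0 ^ n * deriv h z0) (at z0)"
    by (rule has_field_derivative_transform_within_open[of _ _ _ "ball 0 R"]) (use w z0 in auto)
  then have "z0 * deriv w z0 = of_nat n * (z0 * z0 ^ (n - 1)) * h z0 + z0 ^ n * (z0 * deriv h z0)"
    by (simp add: DERIV_imp_deriv algebra_simps)
  also have "z0 * deriv h z0 = c * h z0" using hnz by (simp add: c_def)
  \<comment> \<open>The factor \<open>of_nat n\<close> covers \<open>n = 0\<close>, where the
    truncated \<open>n - 1\<close> is \<open>0\<close>.\<close>
  also have "of_nat n * (z0 * z0 ^ (n - 1)) = of_nat n * z0 ^ n"
    by (cases n) auto
  also have "c = of_real (Re c)" using c(1) by (simp add: complex_eq_iff)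
  finally have "z0 * deriv w z0 = of_real (n + Re c) * w z0"
    using w[OF z0] by (simp add: algebra_simps)
  then show thesis using c(2) by (intro that[of "n + Re c"]) auto
qed

section \<open>Order of vanishing at 0 read off from growth bounds\<close>

text \<open>Riemann's theorem: \<open>w z / z ^ n\<close> is bounded near 0, so its singularity
  there is removable.\<close>

lemma holomorphic_power_factor:
  fixes w :: "complex \<Rightarrow> complex"
  assumes w: "w holomorphic_on S" and S: "open S" "0 \<in> S" and n: "n > 0" and w0: "w 0 = 0"
    and C: "\<forall>\<^sub>F z in at 0. cmod (w z) \<le> C * cmod z ^ n"
  obtains h where "h holomorphic_on S" "\<And>z. z \<in> S \<Longrightarrow> w z = z ^ n * h z"
proof -
  have 1: "(\<lambda>z. w z / z ^ n) holomorphic_on S - {0}"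
    using holomorphic_on_subset[OF w] by (auto intro!: holomorphic_intros)
  have "\<forall>\<^sub>F z in at (0::complex). z \<noteq> 0" by (simp add: eventually_at_filter)
  then have "\<forall>\<^sub>F z in at 0. cmod (w z / z ^ n) \<le> C"
    using C by eventually_elim (simp add: norm_divide norm_power divide_simps)
  then obtain h where h: "h holomorphic_on S" "\<forall>z\<in>S - {0}. h z = w z / z ^ n"
    using holomorphic_on_extend_bounded[OF 1] S interior_open by blast
  show thesis
  proof (rule that[OF h(1)])
    show "w z = z ^ n * h z" if "z \<in> S" for z
      using h(2) n w0 that by (cases "z = 0") auto
  qed
qed

text \<open>Both bounds follow from \<open>(exp x - 1) / x\<close> tending to 1. They transfer the
  order of vanishing between a logarithm \<open>L\<close> and \<open>exp L - 1\<close>. The filter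
  \<open>nhds\<close> includes \<open>x = 0\<close>, a value that \<open>L\<close> may take near
  0.\<close>

lemma eventually_exp_minus_1_bounds:
  "\<forall>\<^sub>F x in nhds (0::complex). cmod (exp x - 1) \<le> 2 * cmod x \<and> cmod x \<le> 2 * cmod (exp x - 1)"
proof -
  have "((\<lambda>x::complex. cmod ((exp x - 1) / x)) \<longlongrightarrow> cmod 1) (at 0)"
    by (intro tendsto_norm lim_exp_minus_1)
  then have "\<forall>\<^sub>F x in at (0::complex). 1/2 < cmod ((exp x - 1) / x) \<and> cmod ((exp x - 1) / x) < 2"
    by (intro eventually_conj order_tendstoD) auto
  then have "\<forall>\<^sub>F x in at (0::complex). cmod (exp x - 1) \<le> 2 * cmod x \<and> cmod x \<le> 2 * cmod (exp x - 1)"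
    by (rule eventually_mono) (auto simp: norm_divide divide_simps split: if_splits)
  then show ?thesis by (simp add: eventually_nhds_conv_at)
qed

section \<open>The classes \<open>class_A\<close> and the quotient
  \<open>zderiv_quot\<close>\<close>

lemma class_A_factor:
  assumes "f \<in> class_A m"
  obtains A where "A holomorphic_on unit_disk"
    "\<And>z. z \<in> unit_disk \<Longrightarrow> f z = z + z ^ (m + 1) * A z"
proof -
  obtain a where a: "\<And>z. z \<in> unit_disk \<Longrightarrow> (\<lambda>k. a k * z ^ (m + 1 + k)) sums (f z - z)"
    using assms unfolding class_A_def by blast
  have sm: "summable (\<lambda>k. a k * z ^ k)" if z: "z \<in> unit_disk" for z
  proof (cases "z = 0")
    case False
    have "summable (\<lambda>k. (a k * z ^ (m + 1 + k)) / z ^ (m + 1))"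
      using a[OF z] by (intro summable_divide) (rule sums_summable)
    then show ?thesis using False by (simp add: power_add)
  qed auto
  define A where "A z = (\<Sum>k. a k * z ^ k)" for z
  have A: "(\<lambda>k. a k * z ^ k) sums A z" if "z \<in> unit_disk" for z
    using sm[OF that] by (simp add: A_def summable_sums)
  show thesis
  proof (rule that[of A])
    show "A holomorphic_on unit_disk"
      by (rule power_series_holomorphic[of 0 1 a]) (use A in simp)
    show "f z = z + z ^ (m + 1) * A z" if z: "z \<in> unit_disk" for z
      using sums_unique2[OF a[OF z]] sums_mult[OF A[OF z], of "z ^ (m + 1)"]
      by (simp add: power_add algebra_simps)
  qed
qed

lemma class_A_subset_class_A_1:
  assumes "m \<ge> 1" shows "class_A m \<subseteq> class_A 1"
proof
  fix f assume f: "f \<in> class_A m"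
  then obtain a where a: "\<And>z. z \<in> unit_disk \<Longrightarrow> (\<lambda>k. a k * z ^ (m + 1 + k)) sums (f z - z)"
    unfolding class_A_def by blast
  \<comment> \<open>The series for \<open>m\<close> starts at \<open>z ^ (m + 1)\<close>, the one
    for 1 at \<open>z ^ 2\<close>, so \<open>m - 1\<close> zeros are put in front.\<close>
  define b where "b k = (if k < m - 1 then 0 else a (k - (m - 1)))" for k
  have "(\<lambda>k. b k * z ^ (1 + 1 + k)) sums (f z - z)" if z: "z \<in> unit_disk" for z
  proof -
    have "b (k + (m - 1)) * z ^ (1 + 1 + (k + (m - 1))) = a k * z ^ (m + 1 + k)" for k
    proof -
      have "1 + 1 + (k + (m - 1)) = m + 1 + k" using assms by simp
      moreover have "b (k + (m - 1)) = a k" by (simp add: b_def)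
      ultimately show ?thesis by (simp only:)
    qed
    then have "(\<lambda>k. b (k + (m - 1)) * z ^ (1 + 1 + (k + (m - 1)))) sums (f z - z)"
      using a[OF z] by (simp only:)
    then show ?thesis
      by (subst (asm) sums_zero_iff_shift) (auto simp: b_def)
  qed
  then show "f \<in> class_A 1" using f unfolding class_A_def by blast
qed

text \<open>Writing \<open>g z = z * G z\<close> and cancelling \<open>z\<close> leaves
  \<open>deriv f z / G z\<close>. Numerator and denominator differ from 1 by multiples of
  \<open>z ^ n1\<close> and \<open>z ^ n2\<close>, hence so does their quotient by a multiple of the
  lower power. This also shows that the definition by cases is holomorphic at 0.\<close>

lemma zderiv_quot_expansion:
  assumes f: "f \<in> class_A n1" and g: "g \<in> class_A n2" and n: "n1 \<ge> 1" "n2 \<ge> 1"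
    and gnz: "\<And>z. z \<in> unit_disk - {0} \<Longrightarrow> g z \<noteq> 0"
  obtains P where "P holomorphic_on unit_disk"
    "\<And>z. z \<in> unit_disk \<Longrightarrow> zderiv_quot f g z = 1 + z ^ min n1 n2 * P z"
proof -
  obtain A where A: "A holomorphic_on unit_disk" and fA: "\<And>z. z \<in> unit_disk \<Longrightarrow> f z = z + z ^ (n1 + 1) * A z"
    using class_A_factor[OF f] by blast
  obtain B where B: "B holomorphic_on unit_disk" and gB: "\<And>z. z \<in> unit_disk \<Longrightarrow> g z = z + z ^ (n2 + 1) * B z"
    using class_A_factor[OF g] by blast
  define G where "G z = 1 + z ^ n2 * B z" for z
  have gG: "g z = z * G z" if "z \<in> unit_disk" for z
    using gB[OF that] by (simp add: G_def algebra_simps)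
  have Gnz: "G z \<noteq> 0" if "z \<in> unit_disk" for z
    using gnz[of z] gG[of z] that n by (cases "z = 0") (auto simp: G_def zero_power)
  \<comment> \<open>The derivative of \<open>z ^ (n1 + 1) * A z\<close> is
    \<open>z ^ n1 * D z\<close>.\<close>
  define D where "D z = of_nat (n1 + 1) * A z + z * deriv A z" for z
  have df: "deriv f z = 1 + z ^ n1 * D z" if z: "z \<in> unit_disk" for z
  proof (rule DERIV_imp_deriv)
    have dA: "(A has_field_derivative deriv A z) (at z)"
      using A z by (intro holomorphic_derivI[of A unit_disk]) auto
    have "((\<lambda>z. z + z ^ (n1 + 1) * A z) has_field_derivative 1 + z ^ n1 * D z) (at z)"
      by (rule derivative_eq_intros dA refl)+ (simp add: D_def algebra_simps)
    then show "(f has_field_derivative 1 + z ^ n1 * D z) (at z)"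
      by (rule has_field_derivative_transform_within_open[of _ _ _ unit_disk]) (use fA z in auto)
  qed
  define m where "m = min n1 n2"
  define P where "P z = (z ^ (n1 - m) * D z - z ^ (n2 - m) * B z) / G z" for z
  show thesis
  proof (rule that[of P])
    show "P holomorphic_on unit_disk"
      using Gnz unfolding P_def D_def G_def
      by (intro holomorphic_intros A B holomorphic_deriv) auto
    show "zderiv_quot f g z = 1 + z ^ min n1 n2 * P z" if z: "z \<in> unit_disk" for z
    proof -
      have "z ^ m * z ^ (n1 - m) = z ^ n1" "z ^ m * z ^ (n2 - m) = z ^ n2"
        by (simp_all add: m_def flip: power_add)
      then have "z ^ m * (z ^ (n1 - m) * D z - z ^ (n2 - m) * B z) = z ^ n1 * D z - z ^ n2 * B z"
        by (metis mult.assoc right_diff_distrib)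
      then have "1 + z ^ m * P z = deriv f z / G z"
        using Gnz[OF z]
        by (simp add: P_def df[OF z] eq_divide_eq distrib_right) (simp add: G_def)
      \<comment> \<open>At 0 the prescribed value 1 is the right one, since both positive powers of
        \<open>z\<close> vanish.\<close>
      moreover have "zderiv_quot f g z = deriv f z / G z"
        using n gG[OF z] df[OF z] by (auto simp: zderiv_quot_def G_def zero_power)
      ultimately show ?thesis by (simp add: m_def)
    qed
  qed
qed

lemma zderiv_quot_logderiv:
  assumes f: "f holomorphic_on unit_disk" and g: "g holomorphic_on unit_disk"
    and z: "z \<in> unit_disk" "z \<noteq> 0" and nz: "g z \<noteq> 0" "deriv f z \<noteq> 0"
  shows "z * deriv (zderiv_quot f g) z =
    (1 + z * deriv (deriv f) z / deriv f z - zderiv_quot g g z) * zderiv_quot f g z"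
proof -
  have df: "(deriv f has_field_derivative deriv (deriv f) z) (at z)"
    using f z by (intro holomorphic_derivI[of "deriv f" unit_disk] holomorphic_deriv) auto
  have dg: "(g has_field_derivative deriv g z) (at z)"
    using g z by (intro holomorphic_derivI[of g unit_disk]) auto
  have "((\<lambda>z. z * deriv f z / g z) has_field_derivative
      ((deriv f z + z * deriv (deriv f) z) * g z - z * deriv f z * deriv g z) / (g z * g z)) (at z)"
    by (rule derivative_eq_intros df dg refl nz)+ simp
  then have "(zderiv_quot f g has_field_derivative
      ((deriv f z + z * deriv (deriv f) z) * g z - z * deriv f z * deriv g z) / (g z * g z)) (at z)"
    by (rule has_field_derivative_transform_within_open[of _ _ _ "- {0}"])
       (use z in \<open>auto simp: zderiv_quot_def\<close>)
  then show ?thesis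
    using z nz by (simp add: DERIV_imp_deriv zderiv_quot_def field_simps)
qed

section \<open>The lower bound for the second factor\<close>

text \<open>In terms of \<open>x = Re t\<close>, the square of the right-hand modulus is a fractional linear
  function, nonincreasing because \<open>\<delta> / (\<delta> + c) \<le> \<rho>\<^sup>2\<close>, so it is smallest at \<open>t = \<rho>\<close>.\<close>

lemma norm_add_mult_quotient_ge:
  fixes t :: complex and \<delta> c \<rho> :: real
  assumes t: "cmod t = \<rho>" "1 + t \<noteq> 0" and \<delta>: "\<delta> > 0" and c: "c \<ge> 0" and \<rho>: "\<rho> \<ge> 0"
    and le: "\<delta> \<le> \<rho>\<^sup>2 * (\<delta> + c)"
  shows "\<delta> + c * \<rho> / (1 + \<rho>) \<le> cmod (of_real \<delta> + of_real c * t / (1 + t))"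
proof -
  define x where "x = Re t"
  have n1: "(cmod (1 + t))\<^sup>2 = 1 + 2 * x + \<rho>\<^sup>2"
    unfolding t(1)[symmetric] unfolding cmod_power2 by (simp add: x_def power2_eq_square algebra_simps)
  have n2: "(cmod (of_real \<delta> + of_real (\<delta> + c) * t))\<^sup>2 = \<delta>\<^sup>2 + 2 * \<delta> * (\<delta> + c) * x + (\<delta> + c)\<^sup>2 * \<rho>\<^sup>2"
    unfolding t(1)[symmetric] unfolding cmod_power2 by (simp add: x_def power2_eq_square algebra_simps)
  have x: "x \<le> \<rho>" using complex_Re_le_cmod[of t] t by (simp add: x_def)
  \<comment> \<open>The difference of the squares, cleared of denominators, is linear in
    \<open>x\<close> by \<open>n1\<close> and \<open>n2\<close>. It vanishes at
    \<open>x = \<rho>\<close>, which explains the factor \<open>\<rho> - x\<close>; the remaining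
    factors are minus its slope.\<close>
  have "0 \<le> 2 * c * (\<rho> - x) * (\<rho>\<^sup>2 * (\<delta> + c) - \<delta>)"
    using x c le by (intro mult_nonneg_nonneg) auto
  also have "\<dots> = (1 + \<rho>)\<^sup>2 * (\<delta>\<^sup>2 + 2 * \<delta> * (\<delta> + c) * x + (\<delta> + c)\<^sup>2 * \<rho>\<^sup>2)
      - (\<delta> + (\<delta> + c) * \<rho>)\<^sup>2 * (1 + 2 * x + \<rho>\<^sup>2)"
    by (simp add: power2_eq_square algebra_simps)
  finally have "((\<delta> + (\<delta> + c) * \<rho>) * cmod (1 + t))\<^sup>2
      \<le> ((1 + \<rho>) * cmod (of_real \<delta> + of_real (\<delta> + c) * t))\<^sup>2"
    by (simp only: power_mult_distrib n1 n2)
  then have le': "(\<delta> + (\<delta> + c) * \<rho>) * cmod (1 + t)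
      \<le> (1 + \<rho>) * cmod (of_real \<delta> + of_real (\<delta> + c) * t)"
    using \<rho> by (auto dest!: power2_le_imp_le)
  have "of_real \<delta> + of_real c * t / (1 + t) = (of_real \<delta> + of_real (\<delta> + c) * t) / (1 + t)"
    using t(2) by (simp add: field_simps)
  moreover have "\<delta> + c * \<rho> / (1 + \<rho>) = (\<delta> + (\<delta> + c) * \<rho>) / (1 + \<rho>)"
    using \<rho> by (simp add: field_simps)
  moreover have "cmod (1 + t) > 0" using t(2) by simp
  ultimately show ?thesis
    using le' \<rho> by (simp add: norm_divide divide_simps mult_ac)
qed

section \<open>The first point where a level is reached\<close>

text \<open>The points of a closed disk with \<open>cmod (w z)\<close> at least
  \<open>\<rho>\<close> form a closed nonempty set; \<open>z0\<close> is one nearest to 0.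
  Minimality gives a strict inequality inside its circle, and continuity the weak one on it.\<close>

lemma first_point_on_level:
  fixes w :: "complex \<Rightarrow> complex"
  assumes w: "continuous_on (ball 0 R) w" and w0: "cmod (w 0) < \<rho>"
    and z1: "z1 \<in> ball 0 R" "cmod (w z1) \<ge> \<rho>"
  obtains z0 where "z0 \<in> ball 0 R" "z0 \<noteq> 0" "cmod (w z0) = \<rho>"
    "\<And>z. cmod z \<le> cmod z0 \<Longrightarrow> cmod (w z) \<le> \<rho>"
proof -
  define K where "K = {z \<in> cball 0 (cmod z1). \<rho> \<le> cmod (w z)}"
  have cw: "continuous_on (cball 0 (cmod z)) w" if "z \<in> ball 0 R" for z
    using that by (intro continuous_on_subset[OF w]) auto
  have "closed K"
    unfolding K_def
    by (intro continuous_on_closed_Collect_le continuous_intros cw z1) auto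
  moreover have "z1 \<in> K" using z1 by (simp add: K_def)
  ultimately obtain z0 where z0: "z0 \<in> K" "\<And>y. y \<in> K \<Longrightarrow> dist 0 z0 \<le> dist 0 y"
    using distance_attains_inf[of K 0] by blast
  have z0R: "z0 \<in> ball 0 R" using z0(1) z1 by (auto simp: K_def)
  have z0nz: "z0 \<noteq> 0" using z0(1) w0 by (auto simp: K_def)
  have lt: "cmod (w z) < \<rho>" if "z \<in> ball 0 (cmod z0)" for z
    using z0(2)[of z] z0(1) that by (force simp: K_def)
  have le: "cmod (w z) \<le> \<rho>" if "cmod z \<le> cmod z0" for z
  \<comment> \<open>As \<open>z0\<close> is not 0, the closed disk of radius \<open>cmod z0\<close>
    is the closure of the open one.\<close>
  proof (rule continuous_le_on_closure[of "ball 0 (cmod z0)" "\<lambda>z. cmod (w z)"])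
    show "continuous_on (closure (ball 0 (cmod z0))) (\<lambda>z. cmod (w z))"
      using z0nz by (simp add: continuous_on_norm cw[OF z0R])
  qed (use that z0nz lt less_imp_le in auto)
  show thesis
    using le[of z0] z0(1) by (intro that[of z0] z0R z0nz le) (auto simp: K_def)
qed

lemma rpow_nonneg: "rpow x a \<ge> 0"
  by (simp add: rpow_def)

lemma rpow_mono: "0 \<le> x \<Longrightarrow> x \<le> y \<Longrightarrow> 0 \<le> a \<Longrightarrow> rpow x a \<le> rpow y a"
  by (simp add: rpow_def powr_mono2)

section \<open>Branches of powers on the disk\<close>

text \<open>The order of vanishing passes from \<open>q - 1\<close> to the logarithm
  \<open>L\<close>, then to \<open>a * L\<close>, and by the exponential to the power minus
  1.\<close>

lemma disk_powr_minus_1_factor: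
  assumes q: "q holomorphic_on unit_disk" "\<And>z. z \<in> unit_disk \<Longrightarrow> q z \<noteq> 0"
    and P: "P holomorphic_on unit_disk" "\<And>z. z \<in> unit_disk \<Longrightarrow> q z = 1 + z ^ n * P z" and n: "n > 0"
  obtains h where "h holomorphic_on unit_disk"
    "\<And>z. z \<in> unit_disk \<Longrightarrow> disk_powr q a z - 1 = z ^ n * h z"
proof -
  define L where "L = disk_log q"
  have "q 0 = 1" using P(2)[of 0] n by simp
  then have L: "L holomorphic_on unit_disk" "L 0 = 0" "\<And>z. z \<in> unit_disk \<Longrightarrow> exp (L z) = q z"
    using disk_log_spec[OF q] by (auto simp: L_def)
  define B where "B = cmod (P 0) + 1"
  have cont: "isCont F 0" if "F holomorphic_on unit_disk" for F
    using holomorphic_on_imp_continuous_on[OF that] by (simp add: continuous_on_eq_continuous_at)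
  have tL: "(L \<longlongrightarrow> 0) (at 0)" using cont[OF L(1)] L(2) by (simp add: isCont_def)
  then have taL: "((\<lambda>z. of_real a * L z) \<longlongrightarrow> 0) (at 0)" by (rule tendsto_mult_right_zero)
  have "((\<lambda>z. cmod (P z)) \<longlongrightarrow> cmod (P 0)) (at 0)"
    using cont[OF P(1)] by (auto simp: isCont_def intro: tendsto_norm)
  then have evP: "\<forall>\<^sub>F z in at 0. cmod (P z) < B"
    by (rule order_tendstoD) (simp add: B_def)
  have evU: "\<forall>\<^sub>F z in at 0. z \<in> unit_disk"
    by (rule eventually_at_in_open') auto
  \<comment> \<open>The 4 collects a factor 2 from each use of the exponential bounds;
    \<open>B\<close> bounds \<open>P\<close> near 0.\<close>
  have "\<forall>\<^sub>F z in at 0. cmod (disk_powr q a z - 1) \<le> (4 * \<bar>a\<bar> * B) * cmod z ^ n"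
    using eventually_compose_filterlim[OF eventually_exp_minus_1_bounds tL]
      eventually_compose_filterlim[OF eventually_exp_minus_1_bounds taL] evP evU
  proof eventually_elim
    case (elim z)
    have "cmod (disk_powr q a z - 1) \<le> 2 * (\<bar>a\<bar> * cmod (L z))"
      using elim(2) by (simp add: disk_powr_def L_def norm_mult)
    also have "\<dots> \<le> 2 * (\<bar>a\<bar> * (2 * cmod (exp (L z) - 1)))"
      using elim(1) by (intro mult_left_mono) auto
    also have "exp (L z) - 1 = z ^ n * P z" using L(3)[OF elim(4)] P(2)[OF elim(4)] by simp
    also have "2 * (\<bar>a\<bar> * (2 * cmod (z ^ n * P z))) = (4 * \<bar>a\<bar> * cmod z ^ n) * cmod (P z)"
      by (simp add: norm_mult norm_power)
    also have "\<dots> \<le> (4 * \<bar>a\<bar> * cmod z ^ n) * B"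
      using elim(3) by (intro mult_left_mono) auto
    finally show ?case by (simp add: mult_ac)
  qed
  moreover have "(\<lambda>z. disk_powr q a z - 1) holomorphic_on unit_disk"
    unfolding disk_powr_def using L(1) by (auto intro!: holomorphic_intros simp: L_def)
  moreover have "disk_powr q a 0 - 1 = 0" using L(2) by (simp add: disk_powr_def L_def)
  ultimately show thesis
    using holomorphic_power_factor[of "\<lambda>z. disk_powr q a z - 1" unit_disk n] n that by auto
qed

text \<open>The power is \<open>exp (a * L)\<close> with \<open>exp L = q\<close>, so its
  logarithmic derivative is \<open>a\<close> times that of \<open>q\<close>.\<close>

lemma deriv_disk_powr:
  assumes q: "q holomorphic_on unit_disk" "\<And>z. z \<in> unit_disk \<Longrightarrow> q z \<noteq> 0" "q 0 = 1"
    and z: "z \<in> unit_disk"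
  shows "deriv (disk_powr q a) z = of_real a * disk_powr q a z * deriv q z / q z"
proof -
  define L where "L = disk_log q"
  have L: "L holomorphic_on unit_disk" "L 0 = 0" "\<And>z. z \<in> unit_disk \<Longrightarrow> exp (L z) = q z"
    using disk_log_spec[OF q] by (auto simp: L_def)
  have dL: "(L has_field_derivative deriv L z) (at z)"
    using L(1) z by (intro holomorphic_derivI[of L unit_disk]) auto
  have "((\<lambda>z. exp (L z)) has_field_derivative exp (L z) * deriv L z) (at z)"
    by (auto intro!: derivative_eq_intros dL)
  then have "(q has_field_derivative exp (L z) * deriv L z) (at z)"
    by (rule has_field_derivative_transform_within_open[of _ _ _ unit_disk]) (use L(3) z in auto)
  then have "deriv q z = q z * deriv L z" using L(3)[OF z] by (simp add: DERIV_imp_deriv)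
  moreover have "((\<lambda>z. exp (of_real a * L z)) has_field_derivative
      exp (of_real a * L z) * (of_real a * deriv L z)) (at z)"
    by (auto intro!: derivative_eq_intros dL)
  then have "deriv (disk_powr q a) z = disk_powr q a z * (of_real a * deriv L z)"
    unfolding disk_powr_def[abs_def] by (simp add: L_def DERIV_imp_deriv)
  ultimately show ?thesis using q(2)[OF z] by simp
qed

section \<open>The contradiction at the first point and strong close-to-convexity\<close>

theorem theorem3:
  fixes f g :: "complex \<Rightarrow> complex"
    and n n1 n2 :: nat
    and \<beta> \<gamma> \<mu> \<delta> \<rho> :: real
  assumes "n1 \<ge> 1" and "n2 \<ge> 1" and "n = min n1 n2"
    and "f \<in> class_A n1"
    and "g \<in> class_A n2 \<inter> starlike_class"
    and "\<forall>z\<in>unit_disk. deriv f z \<noteq> 0"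
    and "\<beta> \<ge> 0" and "\<gamma> \<ge> 0" and "\<beta> + \<gamma> > 0"
    and "0 < \<mu>" and "\<mu> \<le> 1"
    and "\<delta> > 0"
    and "\<rho> > sqrt (\<delta> / (\<delta> + \<mu> * real n))"
    and "\<forall>z\<in>unit_disk.
      rpow (cmod (disk_powr (zderiv_quot f g) (1 / \<mu>) z - 1)) \<beta> *
      rpow (cmod (of_real \<delta> + 1 + z * deriv (deriv f) z / deriv f z - zderiv_quot g g z)) \<gamma>
      < rpow \<rho> \<beta> * rpow (\<delta> + \<mu> * \<rho> * real n / (1 + \<rho>)) \<gamma>"
  shows "(\<forall>z\<in>unit_disk. cmod (disk_powr (zderiv_quot f g) (1 / \<mu>) z - 1) < \<rho>) \<and>
    (\<rho> < 1 \<longrightarrow> f \<in> STC \<mu>)"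
proof -
  have nn: "n \<ge> 1" using assms(1-3) by simp
  define q where "q = zderiv_quot f g"
  define Q where "Q = disk_powr q (1 / \<mu>)"
  have hol: "f holomorphic_on unit_disk" "g holomorphic_on unit_disk"
    using assms(4,5) by (auto simp: class_A_def)
  have gnz: "g z \<noteq> 0" if "z \<in> unit_disk - {0}" for z
    using that assms(5) by (auto simp: starlike_class_def)
  obtain P where P: "P holomorphic_on unit_disk" "\<And>z. z \<in> unit_disk \<Longrightarrow> q z = 1 + z ^ n * P z"
    using zderiv_quot_expansion[of f n1 g n2] assms(1-5) gnz by (auto simp: q_def)
  have "(\<lambda>z. 1 + z ^ n * P z) holomorphic_on unit_disk" by (intro holomorphic_intros P)
  then have qhol: "q holomorphic_on unit_disk" by (rule holomorphic_transform) (simp add: P)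
  have qnz: "q z \<noteq> 0" if "z \<in> unit_disk" for z
    using gnz[of z] assms(6) that by (auto simp: q_def zderiv_quot_def)
  have q0: "q 0 = 1" by (simp add: q_def zderiv_quot_def)
  obtain h where h: "h holomorphic_on unit_disk" "\<And>z. z \<in> unit_disk \<Longrightarrow> Q z - 1 = z ^ n * h z"
    using disk_powr_minus_1_factor[OF qhol qnz P] nn by (auto simp: Q_def)
  have Qnz: "Q z \<noteq> 0" for z by (simp add: Q_def disk_powr_def)
  have pos: "\<delta> + \<mu> * n > 0" using assms(10,12) by (simp add: add_pos_nonneg)
  have "sqrt (\<delta> / (\<delta> + \<mu> * n)) \<ge> 0" using assms(12) pos by simp
  then have \<rho>: "\<rho> > 0" using assms(13) by linarith
  \<comment> \<open>Squaring the lower bound on \<open>\<rho>\<close> yields the condition of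
    \<open>norm_add_mult_quotient_ge\<close> for \<open>c = \<mu> * n\<close>.\<close>
  have "\<delta> / (\<delta> + \<mu> * n) \<le> \<rho>\<^sup>2"
    using assms(13) by (intro sqrt_le_D) simp
  then have \<rho>2: "\<delta> \<le> \<rho>\<^sup>2 * (\<delta> + \<mu> * n)" using pos by (simp add: field_simps)
  have "(\<lambda>z. z ^ n * h z) holomorphic_on unit_disk" by (intro holomorphic_intros h)
  then have whol: "(\<lambda>z. Q z - 1) holomorphic_on unit_disk"
    by (rule holomorphic_transform) (simp add: h)
  have main: "cmod (Q z - 1) < \<rho>" if z: "z \<in> unit_disk" for z
  proof (rule ccontr)
    assume "\<not> cmod (Q z - 1) < \<rho>"
    moreover have "cmod (Q 0 - 1) < \<rho>" using h(2)[of 0] nn \<rho> by (simp add: zero_power)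
    ultimately obtain z0 where z0: "z0 \<in> unit_disk" "z0 \<noteq> 0" "cmod (Q z0 - 1) = \<rho>"
      and z0le: "\<And>z. cmod z \<le> cmod z0 \<Longrightarrow> cmod (Q z - 1) \<le> \<rho>"
      using first_point_on_level[OF holomorphic_on_imp_continuous_on[OF whol], of \<rho> z] z
      by (auto simp: not_less)
    obtain k :: real where k: "k \<ge> n" "z0 * deriv (\<lambda>z. Q z - 1) z0 = of_real k * (Q z0 - 1)"
    proof (rule Jack[of h 1 "\<lambda>z. Q z - 1" n z0])
      show "Q z0 - 1 \<noteq> 0" using z0(3) \<rho> by auto
      show "cmod (Q z - 1) \<le> cmod (Q z0 - 1)" if "cmod z = cmod z0" for z
        using z0le[of z] z0(3) that by simp
    qed (use h z0 in blast)+
    define t where "t = Q z0 - 1"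
    have "(\<lambda>z. (Q z - 1) + 1) holomorphic_on unit_disk" by (intro holomorphic_intros whol)
    then have "Q holomorphic_on unit_disk" by simp
    then have "deriv (\<lambda>z. Q z - 1) z0 = deriv Q z0"
      using z0 by (subst deriv_diff) (auto intro: holomorphic_on_imp_differentiable_at)
    then have "of_real k * t = z0 * (of_real (1 / \<mu>) * Q z0 * deriv q z0 / q z0)"
      using k(2) deriv_disk_powr[OF qhol qnz q0 z0(1), of "1 / \<mu>"] by (simp add: Q_def t_def)
    then have "z0 * deriv q z0 / q z0 = of_real (\<mu> * k) * t / (1 + t)"
      using assms(10) Qnz[of z0] qnz[OF z0(1)] by (simp add: t_def field_simps)
    moreover have "z0 * deriv q z0 / q z0 =
        1 + z0 * deriv (deriv f) z0 / deriv f z0 - zderiv_quot g g z0"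
      using zderiv_quot_logderiv[OF hol z0(1,2)] gnz[of z0] z0 assms(6) qnz[OF z0(1)]
      by (simp add: q_def)
    ultimately have eq: "of_real \<delta> + 1 + z0 * deriv (deriv f) z0 / deriv f z0 - zderiv_quot g g z0
        = of_real \<delta> + of_real (\<mu> * k) * t / (1 + t)"
      by (simp add: algebra_simps)
    have \<mu>k: "\<mu> * n \<le> \<mu> * k" using k(1) assms(10) by simp
    \<comment> \<open>The target bound grows with \<open>n\<close>, so it suffices to prove it with
      the possibly larger \<open>k\<close>.\<close>
    have "\<delta> + \<mu> * \<rho> * n / (1 + \<rho>) \<le> \<delta> + (\<mu> * k) * \<rho> / (1 + \<rho>)"
      using mult_right_mono[OF \<mu>k, of \<rho>] \<rho> by (simp add: divide_right_mono mult_ac)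
    also have "\<dots> \<le> cmod (of_real \<delta> + of_real (\<mu> * k) * t / (1 + t))"
    proof (rule norm_add_mult_quotient_ge)
      \<comment> \<open>The condition persists when \<open>\<mu> * n\<close> is replaced by the
        larger \<open>\<mu> * k\<close>.\<close>
      show "\<delta> \<le> \<rho>\<^sup>2 * (\<delta> + \<mu> * k)"
        using \<rho>2 mult_left_mono[OF \<mu>k, of "\<rho>\<^sup>2"] by (simp add: algebra_simps)
      show "0 \<le> \<mu> * k" using \<mu>k assms(10) by (meson mult_nonneg_nonneg less_imp_le of_nat_0_le_iff order_trans)
    qed (use z0 Qnz[of z0] assms(12) \<rho> in \<open>auto simp: t_def\<close>)
    \<comment> \<open>At \<open>z0\<close> the first factor equals
      \<open>rpow \<rho> \<beta>\<close> because \<open>cmod t = \<rho>\<close>, so the strict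
      hypothesis fails there.\<close>
    finally have "rpow \<rho> \<beta> * rpow (\<delta> + \<mu> * \<rho> * n / (1 + \<rho>)) \<gamma>
        \<le> rpow \<rho> \<beta> * rpow (cmod (of_real \<delta> + of_real (\<mu> * k) * t / (1 + t))) \<gamma>"
      using assms(8,10,12) \<rho> by (intro mult_left_mono rpow_mono rpow_nonneg) auto
    then show False
      using bspec[OF assms(14) z0(1)] eq z0(3) by (simp add: Q_def q_def)
  qed
  moreover have "f \<in> STC \<mu>" if "\<rho> < 1"
  proof -
    \<comment> \<open>A disk of radius less than 1 about 1 lies in the right half-plane;
      \<open>g\<close> itself then witnesses membership in \<open>STC\<close>.\<close>
    have "Re (Q z) > 0" if "z \<in> unit_disk" for z
      using main[OF that] \<open>\<rho> < 1\<close> abs_Re_le_cmod[of "Q z - 1"] by simp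
    then show ?thesis
      using assms(4-6) class_A_subset_class_A_1[OF assms(1)]
      unfolding STC_def Q_def q_def by blast
  qed
  ultimately show ?thesis by (auto simp: Q_def q_def)
qed

end
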